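(* We have: (1) The mappings $\sigma_i\mapsto wT_i$ and $\tau_i\mapsto x+ywT_i$ define a monoid homomorphism, denoted $\psi_{n,w,x,y}$, from $SB_n$ to $\mathcal{E}_n(u)$. (2) The mappings $\sigma_i\mapsto wT_i$ and $\tau_i\mapsto xE_i+ywE_iT_i$ define a monoid homomorphism, denoted $\phi_{n,w,x,y}$, from $SB_n$ to $\mathcal{E}_n(u)$. (3) The mappings obtained by replacing $T_i$ with $V_i$ in (1) and (2) define two monoid homomorphisms, denoted respectively $\psi'_{n,w,x,y}$ and $\phi'_{n,w,x,y}$, from $SB_n$ to $\mathcal{E}_n(v)$.
   Context: The singular braid monoid $SB_n$ is generated by $\sigma_1^{\pm1},\dots,\sigma_{n-1}^{\pm1}$ and $\tau_1,\dots,\tau_{n-1}$ subject to the braid relations among the $\sigma_i$ and: $\tau_i\tau_j=\tau_j\tau_i$ and $\sigma_i\tau_j=\tau_j\sigma_i$ for $|i-j|>1$; $\sigma_i\tau_i=\tau_i\sigma_i$ for all $i$; $\sigma_i\sigma_j\tau_i=\tau_j\sigma_i\sigma_j$ for $|i-j|=1$. Let $u$ be an indeterminate and $\mathbb{K}=\mathbb{C}(u)$. The bt-algebra $\mathcal{E}_n(u)$ is the unital associative $\mathbb{K}$-algebra ($\mathcal{E}_1(u)=\mathbb{K}$) generated by $T_1,\dots,T_{n-1},E_1,\dots,E_{n-1}$ with relations: $E_iE_j=E_jE_i$ for all $i,j$; $E_i^2=E_i$; $E_iT_j=T_jE_i$ for $|i-j|>1$; $E_iT_i=T_iE_i$; $E_iT_jT_i=T_jT_iE_j$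 for $|i-j|=1$; $E_iE_jT_i=E_jT_iE_j=T_iE_iE_j$ for $|i-j|=1$; $T_iT_j=T_jT_i$ for $|i-j|>1$; $T_iT_jT_i=T_jT_iT_j$ for $|i-j|=1$; $T_i^2=1+(u-1)E_i+(u-1)E_iT_i$. The $T_i$ are invertible. $w,x,y,a,b$ are commuting variables and scalars are extended from $\mathbb{K}$ to $\mathbb{K}(a,b,x,y,w)$. For $v^2=u$, after adjoining $v$ to the scalars, $V_i:=T_i+(v^{-1}-1)E_iT_i$; the $V_i,E_i$ satisfy the same relations as the $T_i,E_i$ except that the quadratic relation becomes $V_i^2=1+(v-v^{-1})E_iV_i$, and $\mathcal{E}_n(v)$ denotes the algebra in this presentation. *)

theory Defs
  imports
    Complex_Main
    "HOL-Library.FuncSet"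
    "HOL-Library.Poly_Mapping"
    "HOL-Computational_Algebra.Polynomial"
    "HOL-Computational_Algebra.Fraction_Field"
    "HOL-Algebra.QuotRing"
begin

section \<open>Presented monoids\<close>

inductive_set monoid_cong :: "'g set \<Rightarrow> ('g list \<times> 'g list) set \<Rightarrow> ('g list \<times> 'g list) set"
  for A :: "'g set" and R :: "('g list \<times> 'g list) set" where
  rel: "\<lbrakk>(l, r) \<in> R; l \<in> lists A; r \<in> lists A; p \<in> lists A; s \<in> lists A\<rbrakk>
        \<Longrightarrow> (p @ l @ s, p @ r @ s) \<in> monoid_cong A R"
| refl: "x \<in> lists A \<Longrightarrow> (x, x) \<in> monoid_cong A R"
| sym: "(x, y) \<in> monoid_cong A R \<Longrightarrow> (y, x) \<in> monoid_cong A R"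
| trans: "\<lbrakk>(x, y) \<in> monoid_cong A R; (y, z) \<in> monoid_cong A R\<rbrakk> \<Longrightarrow> (x, z) \<in> monoid_cong A R"

definition presented_monoid :: "'g set \<Rightarrow> ('g list \<times> 'g list) set \<Rightarrow> 'g list set monoid" where
  "presented_monoid A R =
    \<lparr>carrier = lists A // monoid_cong A R,
     mult = (\<lambda>X Y. \<Union>x\<in>X. \<Union>y\<in>Y. monoid_cong A R `` {x @ y}),
     one = monoid_cong A R `` {[]}\<rparr>"

lemma monoid_cong_lists:
  assumes "(x, y) \<in> monoid_cong A R"
  shows "x \<in> lists A \<and> y \<in> lists A"
  using assms by induction auto

lemma equiv_monoid_cong: "equiv (lists A) (monoid_cong A R)"
proof (rule equivI)
  show "monoid_cong A R \<subseteq> lists A \<times> lists A"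
    using monoid_cong_lists[of _ _ A R] by auto
  show "refl_on (lists A) (monoid_cong A R)"
    by (auto intro!: refl_onI monoid_cong.refl)
  show "Relation.sym (monoid_cong A R)"
    by (auto intro: symI monoid_cong.sym)
  show "Relation.trans (monoid_cong A R)"
    by (auto intro: transI monoid_cong.trans)
qed

lemma monoid_cong_context:
  assumes "(x, y) \<in> monoid_cong A R" "p \<in> lists A" "s \<in> lists A"
  shows "(p @ x @ s, p @ y @ s) \<in> monoid_cong A R"
  using assms
proof (induction arbitrary: p s)
  case (rel l r p' s')
  then show ?case
    using monoid_cong.rel[of l r R A "p @ p'" "s' @ s"] by simp
next
  case (refl x)
  then show ?case
    by (intro monoid_cong.refl) simp
next
  case (sym x y)
  then show ?case
    by (blast intro: monoid_cong.sym)
next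
  case (trans x y z)
  then show ?case
    by (blast intro: monoid_cong.trans)
qed

lemma presented_monoid_mult_class:
  assumes "x \<in> lists A" "y \<in> lists A"
  shows "monoid_cong A R `` {x} \<otimes>\<^bsub>presented_monoid A R\<^esub> monoid_cong A R `` {y}
         = monoid_cong A R `` {x @ y}"
proof -
  have "monoid_cong A R `` {x' @ y'} = monoid_cong A R `` {x @ y}"
    if "(x, x') \<in> monoid_cong A R" "(y, y') \<in> monoid_cong A R" for x' y'
  proof -
    have "(x @ y, x' @ y) \<in> monoid_cong A R"
      using monoid_cong_context[OF that(1), of "[]" y] assms by simp
    moreover have "(x' @ y, x' @ y') \<in> monoid_cong A R"
      using monoid_cong_context[OF that(2), of x' "[]"] monoid_cong_lists[OF that(1)] by simp
    ultimately have "(x @ y, x' @ y') \<in> monoid_cong A R"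
      by (rule monoid_cong.trans)
    then show ?thesis
      using equiv_class_eq[OF equiv_monoid_cong] by metis
  qed
  moreover have "(x, x) \<in> monoid_cong A R" "(y, y) \<in> monoid_cong A R"
    using assms by (blast intro: monoid_cong.refl)+
  ultimately have "(\<Union>x'\<in>monoid_cong A R `` {x}. \<Union>y'\<in>monoid_cong A R `` {y}. monoid_cong A R `` {x' @ y'})
      = monoid_cong A R `` {x @ y}"
    by blast
  then show ?thesis
    by (simp add: presented_monoid_def)
qed

lemma monoid_presented_monoid: "monoid (presented_monoid A R)"
proof -
  let ?M = "presented_monoid A R"
  have rep: "\<exists>x\<in>lists A. X = monoid_cong A R `` {x}" if "X \<in> carrier ?M" for X
    using that by (auto simp: presented_monoid_def elim: quotientE)
  have cls: "monoid_cong A R `` {x} \<in> carrier ?M" if "x \<in> lists A" for x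
    using that by (simp add: presented_monoid_def quotientI)
  have one: "\<one>\<^bsub>?M\<^esub> = monoid_cong A R `` {[]}"
    by (simp add: presented_monoid_def)
  show ?thesis
  proof (rule monoidI)
    fix X Y assume "X \<in> carrier ?M" "Y \<in> carrier ?M"
    then show "X \<otimes>\<^bsub>?M\<^esub> Y \<in> carrier ?M"
      by (metis rep cls presented_monoid_mult_class append_in_lists_conv)
  next
    show "\<one>\<^bsub>?M\<^esub> \<in> carrier ?M"
      using cls one by simp
  next
    fix X Y Z assume "X \<in> carrier ?M" "Y \<in> carrier ?M" "Z \<in> carrier ?M"
    then obtain x y z where "x \<in> lists A" "y \<in> lists A" "z \<in> lists A"
      "X = monoid_cong A R `` {x}" "Y = monoid_cong A R `` {y}" "Z = monoid_cong A R `` {z}"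
      using rep by metis
    then show "X \<otimes>\<^bsub>?M\<^esub> Y \<otimes>\<^bsub>?M\<^esub> Z = X \<otimes>\<^bsub>?M\<^esub> (Y \<otimes>\<^bsub>?M\<^esub> Z)"
      by (simp add: presented_monoid_mult_class)
  next
    fix X assume "X \<in> carrier ?M"
    then obtain x where "x \<in> lists A" "X = monoid_cong A R `` {x}"
      using rep by metis
    then show "\<one>\<^bsub>?M\<^esub> \<otimes>\<^bsub>?M\<^esub> X = X" "X \<otimes>\<^bsub>?M\<^esub> \<one>\<^bsub>?M\<^esub> = X"
      using presented_monoid_mult_class[of "[]" A x R] presented_monoid_mult_class[of x A "[]" R]
      by (simp_all add: one)
  qed
qed


section \<open>The singular braid monoid\<close>

datatype sb_gen = Sigma nat | Sigma_inv nat | Tau nat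

definition sb_gens :: "nat \<Rightarrow> sb_gen set" where
  "sb_gens n = Sigma ` {1..<n} \<union> Sigma_inv ` {1..<n} \<union> Tau ` {1..<n}"

abbreviation far :: "nat \<Rightarrow> nat \<Rightarrow> bool" where
  "far i j \<equiv> \<bar>int i - int j\<bar> > 1"

abbreviation adjacent :: "nat \<Rightarrow> nat \<Rightarrow> bool" where
  "adjacent i j \<equiv> \<bar>int i - int j\<bar> = 1"

inductive_set sb_rels :: "nat \<Rightarrow> (sb_gen list \<times> sb_gen list) set" for n :: nat where
  inv_right: "i \<in> {1..<n} \<Longrightarrow> ([Sigma i, Sigma_inv i], []) \<in> sb_rels n"
| inv_left: "i \<in> {1..<n} \<Longrightarrow> ([Sigma_inv i, Sigma i], []) \<in> sb_rels n"
| sigma_far: "\<lbrakk>i \<in> {1..<n}; j \<in> {1..<n}; far i j\<rbrakk>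
    \<Longrightarrow> ([Sigma i, Sigma j], [Sigma j, Sigma i]) \<in> sb_rels n"
| sigma_braid: "\<lbrakk>i \<in> {1..<n}; j \<in> {1..<n}; adjacent i j\<rbrakk>
    \<Longrightarrow> ([Sigma i, Sigma j, Sigma i], [Sigma j, Sigma i, Sigma j]) \<in> sb_rels n"
| tau_far: "\<lbrakk>i \<in> {1..<n}; j \<in> {1..<n}; far i j\<rbrakk>
    \<Longrightarrow> ([Tau i, Tau j], [Tau j, Tau i]) \<in> sb_rels n"
| sigma_tau_far: "\<lbrakk>i \<in> {1..<n}; j \<in> {1..<n}; far i j\<rbrakk>
    \<Longrightarrow> ([Sigma i, Tau j], [Tau j, Sigma i]) \<in> sb_rels n"
| sigma_tau_same: "i \<in> {1..<n} \<Longrightarrow> ([Sigma i, Tau i], [Tau i, Sigma i]) \<in> sb_rels n"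
| sigma_tau_braid: "\<lbrakk>i \<in> {1..<n}; j \<in> {1..<n}; adjacent i j\<rbrakk>
    \<Longrightarrow> ([Sigma i, Sigma j, Tau i], [Tau j, Sigma i, Sigma j]) \<in> sb_rels n"

definition SB :: "nat \<Rightarrow> sb_gen list set monoid" where
  "SB n = presented_monoid (sb_gens n) (sb_rels n)"

definition sb_sigma :: "nat \<Rightarrow> nat \<Rightarrow> sb_gen list set" where
  "sb_sigma n i = monoid_cong (sb_gens n) (sb_rels n) `` {[Sigma i]}"

definition sb_tau :: "nat \<Rightarrow> nat \<Rightarrow> sb_gen list set" where
  "sb_tau n i = monoid_cong (sb_gens n) (sb_rels n) `` {[Tau i]}"

text \<open>Homomorphisms are made extensional, i.e. they are functions on the carrier, so that
  uniqueness is meaningful. Note that \<^const>\<open>hom\<close> alone does not require preservation of the unit.\<close>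

definition monoid_homs :: "('a, 'm) monoid_scheme \<Rightarrow> ('b, 'p) monoid_scheme \<Rightarrow> ('a \<Rightarrow> 'b) set" where
  "monoid_homs G H = {h \<in> hom G H. h \<one>\<^bsub>G\<^esub> = \<one>\<^bsub>H\<^esub>} \<inter> extensional (carrier G)"

text \<open>The assignment \<open>\<sigma>\<^sub>i \<mapsto> s i\<close>, \<open>\<tau>\<^sub>i \<mapsto> t i\<close> defines a monoid homomorphism.
  The values at the inverses of the \<open>\<sigma>\<^sub>i\<close> are not prescribed, but forced.\<close>

definition defines_SB_hom ::
  "nat \<Rightarrow> ('b, 'p) monoid_scheme \<Rightarrow> (nat \<Rightarrow> 'b) \<Rightarrow> (nat \<Rightarrow> 'b) \<Rightarrow> bool" where
  "defines_SB_hom n M s t \<longleftrightarrow>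
    (\<exists>!h. h \<in> monoid_homs (SB n) M \<and>
      (\<forall>i\<in>{1..<n}. h (sb_sigma n i) = s i \<and> h (sb_tau n i) = t i))"


section \<open>Presented algebras\<close>

text \<open>The free monoid on \<open>'g\<close>, written additively, so that finitely supported functions on it
  form the free associative algebra with the convolution product of \<^theory>\<open>HOL-Library.Poly_Mapping\<close>.\<close>

datatype 'g word = Word (letters: "'g list")

instantiation word :: (type) monoid_add
begin

definition zero_word :: "'a word" where
  "zero_word = Word []"

definition plus_word :: "'a word \<Rightarrow> 'a word \<Rightarrow> 'a word" where
  "plus_word x y = Word (letters x @ letters y)"

instance
  by standard (simp_all add: zero_word_def plus_word_def)

end

type_synonym ('g, 'k) nc_poly = "'g word \<Rightarrow>\<^sub>0 'k"

definition nc_gen :: "'g \<Rightarrow> ('g, 'k::field) nc_poly" where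
  "nc_gen g = Poly_Mapping.single (Word [g]) 1"

definition nc_const :: "'k \<Rightarrow> ('g, 'k::field) nc_poly" where
  "nc_const c = Poly_Mapping.single 0 c"

definition free_algebra :: "'g set \<Rightarrow> ('g, 'k::field) nc_poly ring" where
  "free_algebra A =
    \<lparr>carrier = {p. \<forall>w \<in> Poly_Mapping.keys p. letters w \<in> lists A},
     mult = (*), one = 1, zero = 0, add = (+)\<rparr>"

lemma ring_free_algebra: "ring (free_algebra A :: ('g, 'k::field) nc_poly ring)"
proof -
  let ?F = "free_algebra A :: ('g, 'k) nc_poly ring"
  have mult_closed: "p * q \<in> carrier ?F" if "p \<in> carrier ?F" "q \<in> carrier ?F" for p q
  proof -
    have "letters w \<in> lists A" if "w \<in> Poly_Mapping.keys (p * q)" for w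
    proof -
      obtain a b where "w = a + b" "a \<in> Poly_Mapping.keys p" "b \<in> Poly_Mapping.keys q"
        using \<open>w \<in> Poly_Mapping.keys (p * q)\<close> keys_mult[of p q] by blast
      moreover from this have "letters a \<in> lists A" "letters b \<in> lists A"
        using \<open>p \<in> carrier ?F\<close> \<open>q \<in> carrier ?F\<close> by (simp_all add: free_algebra_def)
      ultimately show ?thesis
        by (simp add: plus_word_def)
    qed
    then show ?thesis
      by (simp add: free_algebra_def)
  qed
  have add_closed: "p + q \<in> carrier ?F" if "p \<in> carrier ?F" "q \<in> carrier ?F" for p q
    using that Poly_Mapping.keys_add[of p q] unfolding free_algebra_def
    by (simp del: in_lists_conv_set) blast
  have one_closed: "1 \<in> carrier ?F"
    by (simp add: free_algebra_def zero_word_def flip: single_one)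
  have zero_closed: "0 \<in> carrier ?F"
    by (simp add: free_algebra_def)
  have uminus_closed: "- p \<in> carrier ?F" if "p \<in> carrier ?F" for p
    using that by (simp add: free_algebra_def)
  have ops: "mult ?F = (*)" "one ?F = 1" "zero ?F = 0" "add ?F = (+)"
    by (simp_all add: free_algebra_def)
  show ?thesis
  proof (rule ringI)
    show "abelian_group ?F"
    proof (rule abelian_groupI)
      fix p assume "p \<in> carrier ?F"
      then show "\<exists>q \<in> carrier ?F. q \<oplus>\<^bsub>?F\<^esub> p = \<zero>\<^bsub>?F\<^esub>"
        by (intro bexI[of _ "- p"]) (simp_all add: ops uminus_closed)
    qed (simp_all add: ops add_closed zero_closed add_ac)
    show "monoid ?F"
      by (rule monoidI) (simp_all add: ops mult_closed one_closed mult.assoc)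
  qed (simp_all add: ops distrib_left distrib_right)
qed

text \<open>Constants lie in the free algebra and are central, so two-sided ring ideals are exactly
  the algebra ideals, and the scalars act on the quotient through the classes of constants.\<close>

definition relation_ideal ::
  "'g set \<Rightarrow> (('g, 'k::field) nc_poly \<times> ('g, 'k) nc_poly) set \<Rightarrow> ('g, 'k) nc_poly set" where
  "relation_ideal A R = Idl\<^bsub>free_algebra A\<^esub> {l - r | l r. (l, r) \<in> R}"

definition presented_algebra ::
  "'g set \<Rightarrow> (('g, 'k::field) nc_poly \<times> ('g, 'k) nc_poly) set \<Rightarrow> ('g, 'k) nc_poly set ring" where
  "presented_algebra A R = free_algebra A Quot relation_ideal A R"

definition alg_class ::
  "'g set \<Rightarrow> (('g, 'k::field) nc_poly \<times> ('g, 'k) nc_poly) set \<Rightarrow> ('g, 'k) nc_poly \<Rightarrow> ('g, 'k) nc_poly set" where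
  "alg_class A R p = relation_ideal A R +>\<^bsub>free_algebra A\<^esub> p"


section \<open>The bt-algebra\<close>

datatype bt_gen = Braid_gen nat | Tie_gen nat

definition bt_gens :: "nat \<Rightarrow> bt_gen set" where
  "bt_gens n = Braid_gen ` {1..<n} \<union> Tie_gen ` {1..<n}"

abbreviation tT :: "nat \<Rightarrow> (bt_gen, 'k::field) nc_poly" where
  "tT i \<equiv> nc_gen (Braid_gen i)"

abbreviation tE :: "nat \<Rightarrow> (bt_gen, 'k::field) nc_poly" where
  "tE i \<equiv> nc_gen (Tie_gen i)"

text \<open>All defining relations except the quadratic one, which depends on the presentation.\<close>

inductive_set bt_common_rels ::
  "nat \<Rightarrow> ((bt_gen, 'k::field) nc_poly \<times> (bt_gen, 'k) nc_poly) set" for n :: nat where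
  EE: "\<lbrakk>i \<in> {1..<n}; j \<in> {1..<n}\<rbrakk> \<Longrightarrow> (tE i * tE j, tE j * tE i) \<in> bt_common_rels n"
| E_idem: "i \<in> {1..<n} \<Longrightarrow> (tE i ^ 2, tE i) \<in> bt_common_rels n"
| ET_far: "\<lbrakk>i \<in> {1..<n}; j \<in> {1..<n}; far i j\<rbrakk> \<Longrightarrow> (tE i * tT j, tT j * tE i) \<in> bt_common_rels n"
| ET_same: "i \<in> {1..<n} \<Longrightarrow> (tE i * tT i, tT i * tE i) \<in> bt_common_rels n"
| ETT: "\<lbrakk>i \<in> {1..<n}; j \<in> {1..<n}; adjacent i j\<rbrakk>
    \<Longrightarrow> (tE i * tT j * tT i, tT j * tT i * tE j) \<in> bt_common_rels n"
| EET_ETE: "\<lbrakk>i \<in> {1..<n}; j \<in> {1..<n}; adjacent i j\<rbrakk>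
    \<Longrightarrow> (tE i * tE j * tT i, tE j * tT i * tE j) \<in> bt_common_rels n"
| ETE_TEE: "\<lbrakk>i \<in> {1..<n}; j \<in> {1..<n}; adjacent i j\<rbrakk>
    \<Longrightarrow> (tE j * tT i * tE j, tT i * tE i * tE j) \<in> bt_common_rels n"
| TT_far: "\<lbrakk>i \<in> {1..<n}; j \<in> {1..<n}; far i j\<rbrakk> \<Longrightarrow> (tT i * tT j, tT j * tT i) \<in> bt_common_rels n"
| TTT: "\<lbrakk>i \<in> {1..<n}; j \<in> {1..<n}; adjacent i j\<rbrakk>
    \<Longrightarrow> (tT i * tT j * tT i, tT j * tT i * tT j) \<in> bt_common_rels n"

definition bt_rels :: "nat \<Rightarrow> 'k::field \<Rightarrow> ((bt_gen, 'k) nc_poly \<times> (bt_gen, 'k) nc_poly) set" where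
  "bt_rels n u = bt_common_rels n \<union>
    {(tT i ^ 2, 1 + nc_const (u - 1) * tE i + nc_const (u - 1) * tE i * tT i) | i. i \<in> {1..<n}}"

definition btV_rels :: "nat \<Rightarrow> 'k::field \<Rightarrow> ((bt_gen, 'k) nc_poly \<times> (bt_gen, 'k) nc_poly) set" where
  "btV_rels n v = bt_common_rels n \<union>
    {(tT i ^ 2, 1 + nc_const (v - inverse v) * tE i * tT i) | i. i \<in> {1..<n}}"

text \<open>\<open>\<E>\<^sub>n(u)\<close> over an arbitrary field of scalars containing \<open>u\<close>: extension of scalars keeps the
  presentation and only enlarges the field.\<close>

definition bt_algebra :: "nat \<Rightarrow> 'k::field \<Rightarrow> (bt_gen, 'k) nc_poly set ring" where
  "bt_algebra n u = presented_algebra (bt_gens n) (bt_rels n u)"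

definition bt_scalar :: "nat \<Rightarrow> 'k::field \<Rightarrow> 'k \<Rightarrow> (bt_gen, 'k) nc_poly set" where
  "bt_scalar n u c = alg_class (bt_gens n) (bt_rels n u) (nc_const c)"

definition bt_T :: "nat \<Rightarrow> 'k::field \<Rightarrow> nat \<Rightarrow> (bt_gen, 'k) nc_poly set" where
  "bt_T n u i = alg_class (bt_gens n) (bt_rels n u) (tT i)"

definition bt_E :: "nat \<Rightarrow> 'k::field \<Rightarrow> nat \<Rightarrow> (bt_gen, 'k) nc_poly set" where
  "bt_E n u i = alg_class (bt_gens n) (bt_rels n u) (tE i)"

text \<open>The elements \<open>V\<^sub>i = T\<^sub>i + (v\<^sup>-\<^sup>1 - 1) E\<^sub>i T\<^sub>i\<close> of \<open>\<E>\<^sub>n(u)\<close> with \<open>u = v\<^sup>2\<close>.\<close>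

definition bt_V :: "nat \<Rightarrow> 'k::field \<Rightarrow> nat \<Rightarrow> (bt_gen, 'k) nc_poly set" where
  "bt_V n v i =
    (let A = bt_algebra n (v ^ 2) in
      bt_T n (v ^ 2) i \<oplus>\<^bsub>A\<^esub>
      bt_scalar n (v ^ 2) (inverse v - 1) \<otimes>\<^bsub>A\<^esub> bt_E n (v ^ 2) i \<otimes>\<^bsub>A\<^esub> bt_T n (v ^ 2) i)"

text \<open>\<open>\<E>\<^sub>n(v)\<close>, the algebra presented by the \<open>V\<^sub>i\<close> and \<open>E\<^sub>i\<close>.\<close>

definition btV_algebra :: "nat \<Rightarrow> 'k::field \<Rightarrow> (bt_gen, 'k) nc_poly set ring" where
  "btV_algebra n v = presented_algebra (bt_gens n) (btV_rels n v)"

definition btV_scalar :: "nat \<Rightarrow> 'k::field \<Rightarrow> 'k \<Rightarrow> (bt_gen, 'k) nc_poly set" where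
  "btV_scalar n v c = alg_class (bt_gens n) (btV_rels n v) (nc_const c)"

definition btV_V :: "nat \<Rightarrow> 'k::field \<Rightarrow> nat \<Rightarrow> (bt_gen, 'k) nc_poly set" where
  "btV_V n v i = alg_class (bt_gens n) (btV_rels n v) (tT i)"

definition btV_E :: "nat \<Rightarrow> 'k::field \<Rightarrow> nat \<Rightarrow> (bt_gen, 'k) nc_poly set" where
  "btV_E n v i = alg_class (bt_gens n) (btV_rels n v) (tE i)"


section \<open>Scalars\<close>

type_synonym 'k ratfun = "'k poly fract"

definition rf_const :: "'k::field \<Rightarrow> 'k ratfun" where
  "rf_const c = Fract [:c:] 1"

definition rf_var :: "'k::field ratfun" where
  "rf_var = Fract [:0, 1:] 1"

text \<open>\<open>'k(a,b,x,y,w)\<close>, built by adjoining \<open>a\<close>, \<open>b\<close>, \<open>x\<close>, \<open>y\<close>, \<open>w\<close> in this order. The base field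
  \<open>\<complex>(t)\<close> is \<^typ>\<open>complex ratfun\<close>, where \<open>t\<close> plays the role of \<open>u\<close>; after adjoining \<open>v\<close> with
  \<open>v\<^sup>2 = u\<close>, the base field \<open>\<complex>(u)(v)\<close> is \<open>\<complex>(v)\<close>, so \<open>t\<close> plays the role of \<open>v\<close> and \<open>u\<close> is \<open>t\<^sup>2\<close>.\<close>

type_synonym 'k ext = "'k ratfun ratfun ratfun ratfun ratfun"

definition ext_const :: "'k::field \<Rightarrow> 'k ext" where
  "ext_const c = rf_const (rf_const (rf_const (rf_const (rf_const c))))"

definition ext_x :: "'k::field ext" where
  "ext_x = rf_const (rf_const rf_var)"

definition ext_y :: "'k::field ext" where
  "ext_y = rf_const rf_var"

definition ext_w :: "'k::field ext" where
  "ext_w = rf_var"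

end

theory Submission
  imports Defs
begin

text \<open>
  A homomorphism from the monoid presented by \<open>SB\<^sub>n\<close> amounts to invertible images of the \<open>\<sigma>\<^sub>i\<close>
  satisfying the singular braid relations together with the images of the \<open>\<tau>\<^sub>i\<close>. Every relation
  between \<open>\<sigma>\<close>'s and \<open>\<tau>\<close>'s says that a product of \<open>\<sigma>\<close>'s intertwines two \<open>\<tau>\<close>'s, and \<open>T\<^sub>i T\<^sub>j\<close> intertwines
  both \<open>E\<^sub>i, E\<^sub>j\<close> and \<open>T\<^sub>i, T\<^sub>j\<close>, hence also \<open>x E\<^sub>i + z E\<^sub>i T\<^sub>i\<close> and \<open>x E\<^sub>j + z E\<^sub>j T\<^sub>j\<close>. Only some of the
  bt-relations enter, and they survive replacing all \<open>E\<^sub>i\<close> by \<open>1\<close>, so (1) is an instance of (2).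
  The quadratic relation is used for the invertibility of \<open>T\<^sub>i\<close>: it reads
  \<open>T\<^sub>i (T\<^sub>i - d E\<^sub>i) = 1 + b E\<^sub>i\<close>, and \<open>1 + b E\<^sub>i\<close> is invertible for \<open>b \<noteq> -1\<close>. For (3), the elements
  \<open>V\<^sub>i = (1 + c E\<^sub>i) T\<^sub>i\<close> satisfy the same relations inside \<open>\<E>\<^sub>n(v\<^sup>2)\<close>.
\<close>

section \<open>Homomorphisms out of a presented monoid\<close>

definition (in monoid) word_eval :: "('g \<Rightarrow> 'a) \<Rightarrow> 'g list \<Rightarrow> 'a" where
  "word_eval f xs = foldr (\<lambda>g m. f g \<otimes> m) xs \<one>"

context monoid
begin

lemma word_eval_simps [simp]:
  "word_eval f [] = \<one>"
  "word_eval f (g # xs) = f g \<otimes> word_eval f xs"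
  by (simp_all add: word_eval_def)

lemma word_eval_closed:
  assumes "f \<in> A \<rightarrow> carrier G" "xs \<in> lists A"
  shows "word_eval f xs \<in> carrier G"
  using assms(2) by (induction xs) (use assms(1) in auto)

lemma word_eval_append:
  assumes "f \<in> A \<rightarrow> carrier G" "xs \<in> lists A" "ys \<in> lists A"
  shows "word_eval f (xs @ ys) = word_eval f xs \<otimes> word_eval f ys"
  using assms(2)
proof (induction xs)
  case Nil
  then show ?case
    using word_eval_closed[OF assms(1,3)] by simp
next
  case (Cons g xs)
  then have "f g \<in> carrier G" "word_eval f xs \<in> carrier G"
    using assms(1) word_eval_closed[OF assms(1)] by auto
  with Cons show ?case
    using word_eval_closed[OF assms(1,3)] by (simp add: m_assoc)
qed

lemma word_eval_cong:
  assumes f: "f \<in> A \<rightarrow> carrier G"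
    and R: "\<And>l r. (l, r) \<in> R \<Longrightarrow> word_eval f l = word_eval f r"
    and "(x, y) \<in> monoid_cong A R"
  shows "word_eval f x = word_eval f y"
  using assms(3)
proof induction
  case (rel l r p s)
  then show ?case
    by (simp add: word_eval_append[OF f] R)
qed simp_all

text \<open>Evaluation of words is constant on the classes of \<open>monoid_cong\<close>, so it
  descends to the quotient. Together with uniqueness this is the universal property of a
  presentation.\<close>

lemma presented_monoid_hom_exists:
  assumes f: "f \<in> A \<rightarrow> carrier G"
    and R: "\<And>l r. (l, r) \<in> R \<Longrightarrow> word_eval f l = word_eval f r"
  shows "\<exists>h \<in> monoid_homs (presented_monoid A R) G.
    \<forall>g \<in> A. h (monoid_cong A R `` {[g]}) = f g"
proof -
  let ?P = "presented_monoid A R" and ?c = "monoid_cong A R"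
  \<comment> \<open>The choice of representative is immaterial by the fact \<open>h\<close> below;
    the restricted lambda makes the map extensional.\<close>
  define h where "h = (\<lambda>X \<in> carrier ?P. word_eval f (SOME x. x \<in> lists A \<and> X = ?c `` {x}))"
  have carr: "carrier ?P = lists A // ?c"
    by (simp add: presented_monoid_def)
  have h: "h (?c `` {x}) = word_eval f x" if x: "x \<in> lists A" for x
  proof -
    have "\<exists>y. y \<in> lists A \<and> ?c `` {x} = ?c `` {y}"
      using x by blast
    from someI_ex[OF this] have "(x, SOME y. y \<in> lists A \<and> ?c `` {x} = ?c `` {y}) \<in> ?c"
      using eq_equiv_class_iff[OF equiv_monoid_cong x] by blast
    from word_eval_cong[OF f R this] show ?thesis
      using x by (simp add: h_def carr quotientI)
  qed
  have rep: "\<exists>x\<in>lists A. X = ?c `` {x}" if "X \<in> carrier ?P" for X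
    using that by (auto simp: carr elim: quotientE)
  have "h \<in> hom ?P G"
  proof (rule homI)
    fix X assume "X \<in> carrier ?P"
    then show "h X \<in> carrier G"
      using rep h word_eval_closed[OF f] by fastforce
  next
    fix X Y assume "X \<in> carrier ?P" "Y \<in> carrier ?P"
    then obtain x y where "x \<in> lists A" "X = ?c `` {x}" "y \<in> lists A" "Y = ?c `` {y}"
      using rep by meson
    then show "h (X \<otimes>\<^bsub>?P\<^esub> Y) = h X \<otimes> h Y"
      by (simp add: presented_monoid_mult_class h word_eval_append[OF f] del: in_lists_conv_set)
  qed
  moreover have "h \<one>\<^bsub>?P\<^esub> = \<one>"
    using h[of "[]"] by (simp add: presented_monoid_def)
  moreover have "h \<in> extensional (carrier ?P)"
    by (simp add: h_def)
  moreover have "h (?c `` {[g]}) = f g" if "g \<in> A" for g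
    using h[of "[g]"] that r_one[OF funcset_mem[OF f that]] by simp
  ultimately show ?thesis
    by (auto simp: monoid_homs_def)
qed

text \<open>Induction on words: the empty word is settled by preservation of the unit, and the
  values off the carrier by extensionality.\<close>

lemma presented_monoid_hom_unique:
  assumes h: "h \<in> monoid_homs (presented_monoid A R) G"
    and k: "k \<in> monoid_homs (presented_monoid A R) G"
    and eq: "\<And>g. g \<in> A \<Longrightarrow> h (monoid_cong A R `` {[g]}) = k (monoid_cong A R `` {[g]})"
  shows "h = k"
proof (rule extensionalityI)
  let ?P = "presented_monoid A R" and ?c = "monoid_cong A R"
  show "h \<in> extensional (carrier ?P)" "k \<in> extensional (carrier ?P)"
    using h k by (auto simp: monoid_homs_def)
  have carr: "carrier ?P = lists A // ?c"
    by (simp add: presented_monoid_def)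
  have hom: "h \<in> hom ?P G" "k \<in> hom ?P G" and one: "h (?c `` {[]}) = k (?c `` {[]})"
    using h k by (auto simp: monoid_homs_def presented_monoid_def)
  have "h (?c `` {x}) = k (?c `` {x})" if "x \<in> lists A" for x
    using that
  proof (induction x)
    case Nil
    then show ?case by (rule one)
  next
    case (Cons g x)
    have split: "?c `` {g # x} = ?c `` {[g]} \<otimes>\<^bsub>?P\<^esub> ?c `` {x}"
      using Cons.hyps by (subst presented_monoid_mult_class) auto
    have "?c `` {[g]} \<in> carrier ?P" "?c `` {x} \<in> carrier ?P"
      using Cons.hyps by (auto simp: carr intro!: quotientI)
    then show ?case
      using Cons eq by (simp add: split hom_mult[OF hom(1)] hom_mult[OF hom(2)])
  qed
  then show "h X = k X" if "X \<in> carrier ?P" for X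
    using that by (auto simp: carr elim!: quotientE)
qed

section \<open>Homomorphisms out of the singular braid monoid\<close>

text \<open>Products are nested to the right because \<open>word_eval\<close> unfolds words that
  way. Invertibility of \<open>s i\<close> gives the two inverse relations, with
  \<open>Sigma_inv i\<close> sent to \<open>inv (s i)\<close>, and it also forces this value in the
  uniqueness part.\<close>

lemma defines_SB_homI:
  assumes s: "\<And>i. i \<in> {1..<n} \<Longrightarrow> s i \<in> Units G"
    and t: "\<And>i. i \<in> {1..<n} \<Longrightarrow> t i \<in> carrier G"
    and ss: "\<And>i j. \<lbrakk>i \<in> {1..<n}; j \<in> {1..<n}; far i j\<rbrakk> \<Longrightarrow> s i \<otimes> s j = s j \<otimes> s i"
    and sss: "\<And>i j. \<lbrakk>i \<in> {1..<n}; j \<in> {1..<n}; adjacent i j\<rbrakk>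
      \<Longrightarrow> s i \<otimes> (s j \<otimes> s i) = s j \<otimes> (s i \<otimes> s j)"
    and tt: "\<And>i j. \<lbrakk>i \<in> {1..<n}; j \<in> {1..<n}; far i j\<rbrakk> \<Longrightarrow> t i \<otimes> t j = t j \<otimes> t i"
    and st: "\<And>i j. \<lbrakk>i \<in> {1..<n}; j \<in> {1..<n}; far i j\<rbrakk> \<Longrightarrow> s i \<otimes> t j = t j \<otimes> s i"
    and st_same: "\<And>i. i \<in> {1..<n} \<Longrightarrow> s i \<otimes> t i = t i \<otimes> s i"
    and sst: "\<And>i j. \<lbrakk>i \<in> {1..<n}; j \<in> {1..<n}; adjacent i j\<rbrakk>
      \<Longrightarrow> s i \<otimes> (s j \<otimes> t i) = t j \<otimes> (s i \<otimes> s j)"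
  shows "defines_SB_hom n G s t"
proof -
  define f where "f g = (case g of Sigma i \<Rightarrow> s i | Sigma_inv i \<Rightarrow> inv (s i) | Tau i \<Rightarrow> t i)" for g
  let ?c = "monoid_cong (sb_gens n) (sb_rels n)"
  have s_closed: "s i \<in> carrier G" if "i \<in> {1..<n}" for i
    using s[OF that] by (rule Units_closed)
  have f: "f \<in> sb_gens n \<rightarrow> carrier G"
    using s t s_closed by (auto simp: f_def sb_gens_def)
  have "word_eval f l = word_eval f r" if "(l, r) \<in> sb_rels n" for l r
    using that
    by cases (simp_all add: f_def s t s_closed ss sss tt st st_same sst
        del: atLeastLessThan_iff One_nat_def)
  from presented_monoid_hom_exists[OF f this] obtain h
    where h: "h \<in> monoid_homs (SB n) G" and h_gen: "\<And>g. g \<in> sb_gens n \<Longrightarrow> h (?c `` {[g]}) = f g"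
    unfolding SB_def by blast
  have h_vals: "\<forall>i\<in>{1..<n}. h (sb_sigma n i) = s i \<and> h (sb_tau n i) = t i"
    using h_gen by (auto simp: sb_sigma_def sb_tau_def f_def sb_gens_def)
  moreover have "k = h" if k: "k \<in> monoid_homs (SB n) G"
    and k_vals: "\<forall>i\<in>{1..<n}. k (sb_sigma n i) = s i \<and> k (sb_tau n i) = t i" for k
  proof -
    \<comment> \<open>Being unital and multiplicative, \<open>k\<close> sends the class of
      \<open>Sigma_inv i\<close> to a two-sided inverse of \<open>s i\<close>, and such an inverse
      is unique.\<close>
    have k_inv: "k (?c `` {[Sigma_inv i]}) = inv (s i)" if i: "i \<in> {1..<n}" for i
    proof -
      have gens: "Sigma i \<in> sb_gens n" "Sigma_inv i \<in> sb_gens n"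
        using i by (auto simp: sb_gens_def)
      have carr: "?c `` {[g]} \<in> carrier (SB n)" if "g \<in> sb_gens n" for g
        using that by (auto simp: SB_def presented_monoid_def intro!: quotientI)
      have eq: "?c `` {[Sigma i, Sigma_inv i]} = ?c `` {[]}"
        "?c `` {[Sigma_inv i, Sigma i]} = ?c `` {[]}"
        using monoid_cong.rel[OF sb_rels.inv_right[OF i], of "sb_gens n" "[]" "[]"]
          monoid_cong.rel[OF sb_rels.inv_left[OF i], of "sb_gens n" "[]" "[]"] gens
        by (auto intro!: equiv_class_eq[OF equiv_monoid_cong])
      have "?c `` {[Sigma i]} \<otimes>\<^bsub>SB n\<^esub> ?c `` {[Sigma_inv i]} = \<one>\<^bsub>SB n\<^esub>"
        "?c `` {[Sigma_inv i]} \<otimes>\<^bsub>SB n\<^esub> ?c `` {[Sigma i]} = \<one>\<^bsub>SB n\<^esub>"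
        using gens by (simp_all add: SB_def presented_monoid_mult_class eq)
          (simp_all add: presented_monoid_def)
      moreover have khom: "k \<in> hom (SB n) G" and kone: "k \<one>\<^bsub>SB n\<^esub> = \<one>"
        using k by (auto simp: monoid_homs_def)
      moreover have ks: "k (?c `` {[Sigma i]}) = s i"
        using k_vals i by (simp add: sb_sigma_def)
      ultimately have "s i \<otimes> k (?c `` {[Sigma_inv i]}) = \<one>" "k (?c `` {[Sigma_inv i]}) \<otimes> s i = \<one>"
        using hom_mult[OF khom carr[OF gens(1)] carr[OF gens(2)]]
          hom_mult[OF khom carr[OF gens(2)] carr[OF gens(1)]] by simp_all
      moreover have "k (?c `` {[Sigma_inv i]}) \<in> carrier G"
        using khom carr[OF gens(2)] by (rule hom_in_carrier)
      ultimately show ?thesis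
        using inv_unique'[OF s_closed[OF i]] by simp
    qed
    have "k (?c `` {[g]}) = h (?c `` {[g]})" if "g \<in> sb_gens n" for g
      using that k_vals k_inv h_gen[OF that]
      by (auto simp: sb_gens_def sb_sigma_def sb_tau_def f_def)
    then show "k = h"
      using presented_monoid_hom_unique k h unfolding SB_def by blast
  qed
  ultimately show ?thesis
    using h unfolding defines_SB_hom_def by blast
qed

end

section \<open>Intertwining relations in a ring\<close>

text \<open>The inverse of \<open>a \<otimes> b\<close> yields a right inverse of \<open>a\<close>
  and, because the factors commute, a left inverse; the two then coincide.\<close>

lemma (in monoid) Units_of_commuting_product:
  assumes "a \<in> carrier G" "b \<in> carrier G" "a \<otimes> b = b \<otimes> a" "a \<otimes> b \<in> Units G"
  shows "a \<in> Units G"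
proof -
  have "a \<otimes> (b \<otimes> inv (a \<otimes> b)) = \<one>"
    using assms by (simp flip: m_assoc)
  moreover have "(inv (a \<otimes> b) \<otimes> b) \<otimes> a = \<one>"
    using assms by (simp add: m_assoc flip: assms(3))
  moreover from calculation have "inv (a \<otimes> b) \<otimes> b = b \<otimes> inv (a \<otimes> b)"
    using assms inv_unique by (metis Units_inv_closed m_closed)
  ultimately show ?thesis
    using assms(1,2) Units_inv_closed[OF assms(4)] unfolding Units_def
    by (auto intro!: bexI[of _ "b \<otimes> inv (a \<otimes> b)"])
qed

context ring
begin

text \<open>For a fixed intertwiner \<open>a\<close>, the pairs \<open>(b, b')\<close> with
  \<open>a \<otimes> b = b' \<otimes> a\<close> are closed under products and sums. A relation
  between generators thus extends to polynomials in them; commutation is the case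
  \<open>b = b'\<close>.\<close>

lemma intertwine_mult:
  assumes "a \<otimes> b = b' \<otimes> a" "a \<otimes> c = c' \<otimes> a"
    and "a \<in> carrier R" "b \<in> carrier R" "b' \<in> carrier R" "c \<in> carrier R" "c' \<in> carrier R"
  shows "a \<otimes> (b \<otimes> c) = (b' \<otimes> c') \<otimes> a"
proof -
  have "a \<otimes> (b \<otimes> c) = b' \<otimes> (a \<otimes> c)"
    using assms(1,3-) by (simp flip: m_assoc)
  then show ?thesis
    using assms(2-) by (simp add: m_assoc)
qed

lemma intertwine_add:
  assumes "a \<otimes> b = b' \<otimes> a" "a \<otimes> c = c' \<otimes> a"
    and "a \<in> carrier R" "b \<in> carrier R" "b' \<in> carrier R" "c \<in> carrier R" "c' \<in> carrier R"
  shows "a \<otimes> (b \<oplus> c) = (b' \<oplus> c') \<otimes> a"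
  using assms by (simp add: l_distr r_distr)

lemma intertwine_one: "a \<in> carrier R \<Longrightarrow> a \<otimes> \<one> = \<one> \<otimes> a"
  by simp

text \<open>Intertwiners compose: \<open>b\<close> carries \<open>d\<close> to \<open>c\<close>, and
  \<open>a\<close> carries \<open>c\<close> to \<open>c'\<close>.\<close>

lemma intertwine_prod:
  assumes "a \<otimes> c = c' \<otimes> a" "b \<otimes> d = c \<otimes> b"
    and "a \<in> carrier R" "b \<in> carrier R" "c \<in> carrier R" "c' \<in> carrier R" "d \<in> carrier R"
  shows "(a \<otimes> b) \<otimes> d = c' \<otimes> (a \<otimes> b)"
proof -
  have "(a \<otimes> b) \<otimes> d = (a \<otimes> c) \<otimes> b"
    using assms(2-) by (simp add: m_assoc)
  then show ?thesis
    using assms(1,3-) by (simp add: m_assoc)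
qed

lemmas intertwine = intertwine_mult intertwine_add intertwine_one

text \<open>Here \<open>s\<close>, \<open>t\<close> stand for two adjacent braid generators and
  \<open>e\<close>, \<open>f\<close> for their ties. The element \<open>n = s q t s\<close> also
  equals \<open>t p s t\<close> and exchanges \<open>p\<close> and \<open>q\<close>. Hence the left
  side is \<open>p n p = p q n\<close>, the right side is \<open>q n q = q p n\<close>, and
  \<open>p\<close>, \<open>q\<close> commute.\<close>

lemma deformed_braid_relation:
  assumes closed [simp]: "s \<in> carrier R" "t \<in> carrier R" "e \<in> carrier R" "f \<in> carrier R"
      "c \<in> carrier R"
    and c: "s \<otimes> c = c \<otimes> s" "t \<otimes> c = c \<otimes> t" "e \<otimes> c = c \<otimes> e" "f \<otimes> c = c \<otimes> f"
    and ef: "e \<otimes> f = f \<otimes> e"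
    and es: "e \<otimes> s = s \<otimes> e" and ft: "f \<otimes> t = t \<otimes> f"
    and ets: "e \<otimes> t \<otimes> s = t \<otimes> s \<otimes> f" and fst: "f \<otimes> s \<otimes> t = s \<otimes> t \<otimes> e"
    and fsf: "f \<otimes> s \<otimes> f = e \<otimes> f \<otimes> s" and sef: "s \<otimes> e \<otimes> f = e \<otimes> f \<otimes> s"
    and ete: "e \<otimes> t \<otimes> e = e \<otimes> f \<otimes> t" and tef: "t \<otimes> e \<otimes> f = e \<otimes> f \<otimes> t"
    and sts: "s \<otimes> t \<otimes> s = t \<otimes> s \<otimes> t"
    and tte: "(t \<otimes> t) \<otimes> e = e \<otimes> (t \<otimes> t)"
    and t: "t \<in> Units R"
  defines "p \<equiv> \<one> \<oplus> c \<otimes> e" and "q \<equiv> \<one> \<oplus> c \<otimes> f"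
  shows "(p \<otimes> s) \<otimes> (q \<otimes> t) \<otimes> (p \<otimes> s) = (q \<otimes> t) \<otimes> (p \<otimes> s) \<otimes> (q \<otimes> t)"
proof -
  have pq [simp]: "p \<in> carrier R" "q \<in> carrier R"
    by (simp_all add: p_def q_def)
  \<comment> \<open>The tie in \<open>m\<close> plays the role of one joining the outer two of the three strands, hence
    it is symmetric in the two generators.\<close>
  define m where "m = s \<otimes> f \<otimes> t \<otimes> s"
  have m [simp]: "m \<in> carrier R"
    by (simp add: m_def)
  have m_sym: "m = t \<otimes> e \<otimes> s \<otimes> t"
  proof -
    \<comment> \<open>Multiplying by \<open>t\<close> creates the subword \<open>s t s\<close>; the
      braid relation then produces \<open>t t\<close>, which commutes with \<open>e\<close>. Finally
      the unit \<open>t\<close> is cancelled.\<close>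
    have "t \<otimes> m = (t \<otimes> s \<otimes> f) \<otimes> t \<otimes> s"
      by (simp add: m_def m_assoc)
    also have "\<dots> = e \<otimes> t \<otimes> (s \<otimes> t \<otimes> s)"
      by (simp add: m_assoc flip: ets)
    also have "\<dots> = e \<otimes> (t \<otimes> t) \<otimes> (s \<otimes> t)"
      unfolding sts by (simp add: m_assoc)
    also have "\<dots> = t \<otimes> (t \<otimes> e \<otimes> s \<otimes> t)"
      unfolding tte[symmetric] by (simp add: m_assoc)
    finally show ?thesis
      using t by simp
  qed
  have me: "m \<otimes> e = f \<otimes> m"
  proof -
    have "m \<otimes> e = s \<otimes> (f \<otimes> t) \<otimes> (s \<otimes> e)"
      by (simp add: m_def m_assoc)
    also have "\<dots> = s \<otimes> (t \<otimes> (e \<otimes> f)) \<otimes> s"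
      unfolding ft es[symmetric] ef by (simp add: m_assoc)
    also have "\<dots> = s \<otimes> (e \<otimes> f \<otimes> t) \<otimes> s"
      unfolding tef[symmetric] by (simp add: m_assoc)
    also have "\<dots> = s \<otimes> e \<otimes> f \<otimes> t \<otimes> s"
      by (simp add: m_assoc)
    also have "\<dots> = f \<otimes> s \<otimes> f \<otimes> t \<otimes> s"
      by (simp add: sef fsf)
    finally show ?thesis
      by (simp add: m_def m_assoc)
  qed
  have mf: "m \<otimes> f = e \<otimes> m"
  proof -
    have "m \<otimes> f = t \<otimes> (e \<otimes> s) \<otimes> (t \<otimes> f)"
      by (simp add: m_sym m_assoc)
    also have "\<dots> = t \<otimes> (s \<otimes> e \<otimes> f) \<otimes> t"
      unfolding es ft[symmetric] by (simp add: m_assoc)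
    also have "\<dots> = t \<otimes> e \<otimes> f \<otimes> s \<otimes> t"
      unfolding sef by (simp add: m_assoc)
    also have "\<dots> = e \<otimes> t \<otimes> e \<otimes> s \<otimes> t"
      by (simp add: tef ete)
    finally show ?thesis
      by (simp add: m_sym m_assoc)
  qed
  \<comment> \<open>The half twist on three strands; like \<open>m\<close>, it exchanges the ties
    \<open>e\<close> and \<open>f\<close>.\<close>
  let ?w = "s \<otimes> t \<otimes> s"
  have we: "?w \<otimes> e = f \<otimes> ?w"
    using fst es by (simp add: m_assoc[symmetric]) (simp add: m_assoc)
  have wf: "?w \<otimes> f = e \<otimes> ?w"
    unfolding sts using ets ft by (simp add: m_assoc[symmetric]) (simp add: m_assoc)
  \<comment> \<open>This is what remains between the two factors \<open>p\<close> once they are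
    moved to the outside. Expanding \<open>q\<close> gives \<open>?w\<close> plus \<open>c\<close>
    times \<open>m\<close>, so the symmetry and the exchange of ties are inherited from both
    summands.\<close>
  define n where "n = s \<otimes> q \<otimes> t \<otimes> s"
  have n [simp]: "n \<in> carrier R"
    by (simp add: n_def)
  have sc: "s \<otimes> (c \<otimes> r) = c \<otimes> (s \<otimes> r)" "t \<otimes> (c \<otimes> r) = c \<otimes> (t \<otimes> r)"
    "f \<otimes> (c \<otimes> r) = c \<otimes> (f \<otimes> r)" if "r \<in> carrier R" for r
    using that c by (simp_all flip: m_assoc)
  have n_eq: "n = ?w \<oplus> c \<otimes> m"
    by (simp add: n_def q_def m_def l_distr r_distr m_assoc sc)
  have n_sym: "n = t \<otimes> p \<otimes> s \<otimes> t"
    unfolding n_eq sts m_sym by (simp add: p_def l_distr r_distr m_assoc sc)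
  have cm: "m \<otimes> c = c \<otimes> m"
    by (simp add: m_def m_assoc sc c)
  have cn: "n \<otimes> c = c \<otimes> n"
    by (simp add: n_eq l_distr r_distr m_assoc sc c cm)
  have ne: "n \<otimes> e = f \<otimes> n"
  proof -
    have "n \<otimes> e = ?w \<otimes> e \<oplus> c \<otimes> (m \<otimes> e)"
      by (simp add: n_eq l_distr m_assoc)
    also have "\<dots> = f \<otimes> ?w \<oplus> f \<otimes> c \<otimes> m"
      by (simp add: we me c flip: m_assoc)
    finally show ?thesis
      by (simp add: n_eq r_distr m_assoc)
  qed
  have nf: "n \<otimes> f = e \<otimes> n"
  proof -
    have "n \<otimes> f = ?w \<otimes> f \<oplus> c \<otimes> (m \<otimes> f)"
      by (simp add: n_eq l_distr m_assoc)
    also have "\<dots> = e \<otimes> ?w \<oplus> e \<otimes> c \<otimes> m"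
      by (simp add: wf mf c flip: m_assoc)
    finally show ?thesis
      by (simp add: n_eq r_distr m_assoc)
  qed
  have np: "n \<otimes> p = q \<otimes> n" and nq: "n \<otimes> q = p \<otimes> n"
    unfolding p_def q_def by (intro intertwine cn ne nf; simp)+
  have "c \<otimes> p = p \<otimes> c" "f \<otimes> p = p \<otimes> f"
    unfolding p_def by (intro intertwine c ef[symmetric] c[symmetric] refl; simp)+
  then have pq_comm: "p \<otimes> q = q \<otimes> p"
    unfolding q_def by (intro intertwine) simp_all
  have ps: "s \<otimes> p = p \<otimes> s" and qt: "t \<otimes> q = q \<otimes> t"
    unfolding p_def q_def by (intro intertwine c es[symmetric] ft[symmetric]; simp)+
  have "(p \<otimes> s) \<otimes> (q \<otimes> t) \<otimes> (p \<otimes> s) = p \<otimes> (n \<otimes> p)"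
    by (simp add: n_def ps m_assoc)
  also have "\<dots> = q \<otimes> (n \<otimes> q)"
    unfolding np nq by (simp add: pq_comm flip: m_assoc)
  also have "\<dots> = (q \<otimes> t) \<otimes> (p \<otimes> s) \<otimes> (q \<otimes> t)"
    unfolding n_sym by (simp add: qt m_assoc)
  finally show ?thesis .
qed

end

section \<open>Representations of the singular braid monoid in rings\<close>

text \<open>The quadratic relation is left out, so that one argument covers the \<open>T i\<close>,
  their deformations and the case of trivial ties. Scalars enter as a map \<open>sc\<close> into the
  ring, commuting with the generators, because a presented algebra is here merely a ring.\<close>

locale tied_braid_ring = ring R for R (structure) +
  fixes n :: nat and sc :: "'k::field \<Rightarrow> 'a" and T E :: "nat \<Rightarrow> 'a"
  assumes sc_closed [simp, intro]: "sc c \<in> carrier R"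
    and sc_add: "sc (c + d) = sc c \<oplus> sc d"
    and sc_mult: "sc (c * d) = sc c \<otimes> sc d"
    and sc_one: "sc 1 = \<one>"
    and T_closed [simp]: "i \<in> {1..<n} \<Longrightarrow> T i \<in> carrier R"
    and E_closed [simp]: "i \<in> {1..<n} \<Longrightarrow> E i \<in> carrier R"
    and T_sc: "i \<in> {1..<n} \<Longrightarrow> T i \<otimes> sc c = sc c \<otimes> T i"
    and E_sc: "i \<in> {1..<n} \<Longrightarrow> E i \<otimes> sc c = sc c \<otimes> E i"
    and EE: "\<lbrakk>i \<in> {1..<n}; j \<in> {1..<n}\<rbrakk> \<Longrightarrow> E i \<otimes> E j = E j \<otimes> E i"
    and ET_far: "\<lbrakk>i \<in> {1..<n}; j \<in> {1..<n}; far i j\<rbrakk> \<Longrightarrow> E i \<otimes> T j = T j \<otimes> E i"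
    and ET_same: "i \<in> {1..<n} \<Longrightarrow> E i \<otimes> T i = T i \<otimes> E i"
    and ETT: "\<lbrakk>i \<in> {1..<n}; j \<in> {1..<n}; adjacent i j\<rbrakk>
      \<Longrightarrow> E i \<otimes> T j \<otimes> T i = T j \<otimes> T i \<otimes> E j"
    and TT_far: "\<lbrakk>i \<in> {1..<n}; j \<in> {1..<n}; far i j\<rbrakk> \<Longrightarrow> T i \<otimes> T j = T j \<otimes> T i"
    and TTT: "\<lbrakk>i \<in> {1..<n}; j \<in> {1..<n}; adjacent i j\<rbrakk>
      \<Longrightarrow> T i \<otimes> T j \<otimes> T i = T j \<otimes> T i \<otimes> T j"
begin

lemma sc_comm: "sc c \<otimes> sc d = sc d \<otimes> sc c"
  by (metis sc_mult mult.commute)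

lemma sc_lcomm: "r \<in> carrier R \<Longrightarrow> sc c \<otimes> (sc d \<otimes> r) = sc d \<otimes> (sc c \<otimes> r)"
  by (metis sc_comm m_assoc sc_closed)

lemma T_sc': "\<lbrakk>i \<in> {1..<n}; r \<in> carrier R\<rbrakk> \<Longrightarrow> T i \<otimes> (sc c \<otimes> r) = sc c \<otimes> (T i \<otimes> r)"
  by (metis T_sc m_assoc sc_closed T_closed)

lemma E_sc': "\<lbrakk>i \<in> {1..<n}; r \<in> carrier R\<rbrakk> \<Longrightarrow> E i \<otimes> (sc c \<otimes> r) = sc c \<otimes> (E i \<otimes> r)"
  by (metis E_sc m_assoc sc_closed E_closed)

lemmas sc_simps = sc_comm sc_lcomm T_sc T_sc' E_sc E_sc'

lemma sc_unit: "c \<noteq> 0 \<Longrightarrow> sc c \<in> Units R"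
  unfolding Units_def
  by (auto intro!: bexI[of _ "sc (inverse c)"] simp: sc_one simp flip: sc_mult)

lemma sc_zero: "sc 0 = \<zero>"
  by (metis add.r_cancel_one' add_0 sc_add sc_closed)

lemma trivial_ties: "tied_braid_ring R n sc T (\<lambda>_. \<one>)"
  by unfold_locales (simp_all add: sc_add sc_mult sc_one T_sc TT_far TTT
      del: atLeastLessThan_iff One_nat_def)

text \<open>The scalar \<open>w\<close> must be nonzero for the images of the \<open>Sigma i\<close>
  to be units, whereas \<open>x\<close> and \<open>z\<close> are arbitrary. The relations with
  \<open>Tau\<close> are first checked on the letters \<open>T\<close>, \<open>E\<close> and scalars
  and then extended by the intertwining rules.\<close>

lemma defines_SB_hom:
  assumes T_unit: "\<And>i. i \<in> {1..<n} \<Longrightarrow> T i \<in> Units R" and "w \<noteq> 0"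
  shows "defines_SB_hom n R (\<lambda>i. sc w \<otimes> T i) (\<lambda>i. sc x \<otimes> E i \<oplus> sc z \<otimes> E i \<otimes> T i)"
proof (rule defines_SB_homI)
  fix i assume i: "i \<in> {1..<n}"
  note [simp] = T_closed[OF i] E_closed[OF i]
  show "sc w \<otimes> T i \<in> Units R"
    using sc_unit[OF \<open>w \<noteq> 0\<close>] T_unit[OF i] by (rule Units_m_closed)
  show "sc x \<otimes> E i \<oplus> sc z \<otimes> E i \<otimes> T i \<in> carrier R"
    by simp
  let ?t = "sc x \<otimes> E i \<oplus> sc z \<otimes> E i \<otimes> T i"
  \<comment> \<open>Commutation is symmetric, so the roles can be swapped: first the letters act as
    intertwiners of the polynomial \<open>?t\<close>, then \<open>?t\<close> acts as an intertwiner
    of products of letters.\<close>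
  have "T i \<otimes> ?t = ?t \<otimes> T i" "sc w \<otimes> ?t = ?t \<otimes> sc w"
    by (intro intertwine T_sc[OF i] T_sc[OF i, symmetric] ET_same[OF i, symmetric]
        E_sc[OF i, symmetric] sc_comm refl; simp)+
  note t_comm = this[symmetric]
  have "?t \<otimes> (sc w \<otimes> T i) = (sc w \<otimes> T i) \<otimes> ?t"
    by (intro intertwine t_comm; simp)
  then show "sc w \<otimes> T i \<otimes> ?t = ?t \<otimes> (sc w \<otimes> T i)" ..
next
  fix i j assume ij: "i \<in> {1..<n}" "j \<in> {1..<n}"
  note [simp] = T_closed[OF ij(1)] T_closed[OF ij(2)] E_closed[OF ij(1)] E_closed[OF ij(2)]
  note comm = T_sc[OF ij(1)] T_sc[OF ij(1), symmetric] T_sc[OF ij(2)] T_sc[OF ij(2), symmetric]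
    E_sc[OF ij(1)] E_sc[OF ij(1), symmetric] E_sc[OF ij(2)] E_sc[OF ij(2), symmetric] sc_comm
    EE[OF ij]
  {
    assume far: "far i j"
    then have far': "far j i"
      by (simp add: abs_minus_commute)
    note comm = comm TT_far[OF ij far] ET_far[OF ij far] ET_far[OF ij(2,1) far', symmetric]
    show "sc w \<otimes> T i \<otimes> (sc w \<otimes> T j) = sc w \<otimes> T j \<otimes> (sc w \<otimes> T i)"
      using TT_far[OF ij far] ij
      by (simp add: m_assoc sc_simps del: atLeastLessThan_iff One_nat_def)
    let ?t = "sc x \<otimes> E i \<oplus> sc z \<otimes> E i \<otimes> T i"
    \<comment> \<open>Once the image of \<open>Tau i\<close> commutes with every letter of index
      \<open>j\<close> and with scalars, it commutes with the images of \<open>Sigma j\<close> and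
      \<open>Tau j\<close>.\<close>
    have "T j \<otimes> ?t = ?t \<otimes> T j" "E j \<otimes> ?t = ?t \<otimes> E j" and "sc c \<otimes> ?t = ?t \<otimes> sc c" for c
      by (intro intertwine comm comm[symmetric]; simp)+
    note t_comm = this[symmetric]
    show "(sc x \<otimes> E i \<oplus> sc z \<otimes> E i \<otimes> T i) \<otimes> (sc x \<otimes> E j \<oplus> sc z \<otimes> E j \<otimes> T j)
        = (sc x \<otimes> E j \<oplus> sc z \<otimes> E j \<otimes> T j) \<otimes> (sc x \<otimes> E i \<oplus> sc z \<otimes> E i \<otimes> T i)"
      by (intro intertwine t_comm; simp)
    show "sc w \<otimes> T i \<otimes> (sc x \<otimes> E j \<oplus> sc z \<otimes> E j \<otimes> T j)
        = (sc x \<otimes> E j \<oplus> sc z \<otimes> E j \<otimes> T j) \<otimes> (sc w \<otimes> T i)" (is "_ = ?u \<otimes> _")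
    proof -
      have "T i \<otimes> ?u = ?u \<otimes> T i" "sc w \<otimes> ?u = ?u \<otimes> sc w"
        by (intro intertwine comm comm[symmetric]; simp)+
      from intertwine_prod[OF this(2,1)] show ?thesis
        by simp
    qed
  next
    assume adj: "adjacent i j"
    then have adj': "adjacent j i"
      by (simp add: abs_minus_commute)
    show "sc w \<otimes> T i \<otimes> (sc w \<otimes> T j \<otimes> (sc w \<otimes> T i)) = sc w \<otimes> T j \<otimes> (sc w \<otimes> T i \<otimes> (sc w \<otimes> T j))"
      using TTT[OF ij adj] ij by (simp add: m_assoc sc_simps del: atLeastLessThan_iff One_nat_def)
    \<comment> \<open>By the braid relation and by \<open>ETT\<close> with the indices exchanged,
      \<open>?b\<close> carries \<open>T i\<close> to \<open>T j\<close> and \<open>E i\<close> to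
      \<open>E j\<close>, hence the image of \<open>Tau i\<close> to that of \<open>Tau j\<close>.
      The two factors \<open>w\<close> are collected in front as one scalar.\<close>
    let ?b = "T i \<otimes> T j"
    let ?t = "\<lambda>i. sc x \<otimes> E i \<oplus> sc z \<otimes> E i \<otimes> T i"
    have "?b \<otimes> T i = T j \<otimes> ?b" "?b \<otimes> E i = E j \<otimes> ?b" and sc: "?b \<otimes> sc c = sc c \<otimes> ?b" for c
      using TTT[OF ij adj] ETT[OF ij(2,1) adj'] ij
      by (simp_all add: m_assoc sc_simps del: atLeastLessThan_iff One_nat_def)
    then have b: "?b \<otimes> ?t i = ?t j \<otimes> ?b"
      by (intro intertwine; simp)
    have "sc c \<otimes> ?t j = ?t j \<otimes> sc c" for c
      by (intro intertwine comm comm[symmetric]; simp)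
    from intertwine_prod[OF this b] have "(sc (w * w) \<otimes> ?b) \<otimes> ?t i = ?t j \<otimes> (sc (w * w) \<otimes> ?b)"
      by simp
    moreover have "sc (w * w) \<otimes> ?b = (sc w \<otimes> T i) \<otimes> (sc w \<otimes> T j)"
      using ij by (simp add: sc_mult m_assoc sc_simps del: atLeastLessThan_iff One_nat_def)
    ultimately show "sc w \<otimes> T i \<otimes> (sc w \<otimes> T j \<otimes> (sc x \<otimes> E i \<oplus> sc z \<otimes> E i \<otimes> T i))
        = (sc x \<otimes> E j \<oplus> sc z \<otimes> E j \<otimes> T j) \<otimes> (sc w \<otimes> T i \<otimes> (sc w \<otimes> T j))"
      by (simp add: m_assoc)
  }
qed

text \<open>The polynomial \<open>x E i + z E i T i\<close> becomes \<open>x + z T i\<close> when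
  every tie is \<open>1\<close>.\<close>

lemma defines_SB_hom_one:
  assumes "\<And>i. i \<in> {1..<n} \<Longrightarrow> T i \<in> Units R" and "w \<noteq> 0"
  shows "defines_SB_hom n R (\<lambda>i. sc w \<otimes> T i) (\<lambda>i. sc x \<oplus> sc z \<otimes> T i)"
  using tied_braid_ring.defines_SB_hom[OF trivial_ties assms, of x z] by simp

end

section \<open>Idempotent ties, invertibility and deformed generators\<close>

text \<open>The quadratic relation stays outside because its coefficients depend on the
  presentation: \<open>b = d = u - 1\<close> for the \<open>T i\<close>, but \<open>b = 0\<close>
  and \<open>d = v - inverse v\<close> for the \<open>V i\<close>. It appears as the hypothesis
  \<open>T2\<close> instead.\<close>

locale bt_ring = tied_braid_ring +
  assumes E_idem: "i \<in> {1..<n} \<Longrightarrow> E i \<otimes> E i = E i"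
    and EET_ETE: "\<lbrakk>i \<in> {1..<n}; j \<in> {1..<n}; adjacent i j\<rbrakk>
      \<Longrightarrow> E i \<otimes> E j \<otimes> T i = E j \<otimes> T i \<otimes> E j"
    and ETE_TEE: "\<lbrakk>i \<in> {1..<n}; j \<in> {1..<n}; adjacent i j\<rbrakk>
      \<Longrightarrow> E j \<otimes> T i \<otimes> E j = T i \<otimes> E i \<otimes> E j"
begin

text \<open>Since \<open>E i\<close> is idempotent, the elements \<open>1 + c E i\<close> multiply
  like the scalars \<open>1 + c\<close>; the hypothesis says
  \<open>(1 + c) (1 + d) = 1\<close>.\<close>

lemma one_plus_tie_unit:
  assumes "i \<in> {1..<n}" "c + d + c * d = 0"
  shows "\<one> \<oplus> sc c \<otimes> E i \<in> Units R"
proof -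
  note [simp] = T_closed[OF assms(1)] E_closed[OF assms(1)]
  have *: "(\<one> \<oplus> sc c \<otimes> E i) \<otimes> (\<one> \<oplus> sc d \<otimes> E i) = \<one> \<oplus> sc (c + d + c * d) \<otimes> E i" for c d
    using assms(1)
    by (simp add: l_distr r_distr m_assoc sc_simps E_idem sc_add sc_mult a_ac
        del: atLeastLessThan_iff One_nat_def)
  show ?thesis
    unfolding Units_def using *[of c d] *[of d c] assms(2)
    by (auto intro!: bexI[of _ "\<one> \<oplus> sc d \<otimes> E i"] simp: sc_zero add.commute mult.commute)
qed

lemma T_unit_if_quadratic:
  assumes i: "i \<in> {1..<n}"
    and T2: "T i \<otimes> T i = \<one> \<oplus> sc b \<otimes> E i \<oplus> sc d \<otimes> E i \<otimes> T i"
    and "b \<noteq> - 1"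
  shows "T i \<in> Units R"
proof (rule Units_of_commuting_product)
  note [simp] = T_closed[OF i] E_closed[OF i]
  \<comment> \<open>The cofactor \<open>T i - d E i\<close> left after moving the last term of the
    quadratic relation to the other side.\<close>
  let ?b = "T i \<oplus> sc (- d) \<otimes> E i"
  show "T i \<in> carrier R" "?b \<in> carrier R"
    by simp_all
  show "T i \<otimes> ?b = ?b \<otimes> T i"
    by (intro intertwine T_sc[OF i] ET_same[OF i, symmetric] refl; simp)
  have "T i \<otimes> ?b = (\<one> \<oplus> sc b \<otimes> E i) \<oplus> sc (d + - d) \<otimes> (E i \<otimes> T i)"
    unfolding sc_add using T2 i
    by (simp add: l_distr r_distr m_assoc sc_simps ET_same a_ac
        del: atLeastLessThan_iff One_nat_def)
  also have "\<dots> = \<one> \<oplus> sc b \<otimes> E i"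
    by (simp add: sc_zero)
  finally have eq: "T i \<otimes> ?b = \<one> \<oplus> sc b \<otimes> E i" .
  have "1 + b \<noteq> 0"
    using \<open>b \<noteq> - 1\<close> by (simp add: eq_neg_iff_add_eq_0 add.commute)
  \<comment> \<open>The scalar \<open>- b / (1 + b)\<close> is the solution \<open>r\<close> of
    \<open>(1 + b) (1 + r) = 1\<close>.\<close>
  then have "b + - b / (1 + b) + b * (- b / (1 + b)) = 0"
    by (simp add: divide_simps) (simp add: algebra_simps)
  then show "T i \<otimes> ?b \<in> Units R"
    unfolding eq by (rule one_plus_tie_unit[OF i])
qed

text \<open>The square of \<open>T j\<close> is a combination of \<open>1\<close>,
  \<open>E j\<close> and \<open>E j T j\<close>, and \<open>E i\<close> commutes with each of them;
  for \<open>E j T j\<close> this follows from \<open>EET_ETE\<close> and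
  \<open>ETE_TEE\<close>.\<close>

lemma T_square_comm:
  assumes ij: "i \<in> {1..<n}" "j \<in> {1..<n}" "adjacent i j"
    and T2: "T j \<otimes> T j = \<one> \<oplus> sc b \<otimes> E j \<oplus> sc d \<otimes> E j \<otimes> T j"
  shows "E i \<otimes> (T j \<otimes> T j) = (T j \<otimes> T j) \<otimes> E i"
proof -
  note [simp] = T_closed[OF ij(1)] T_closed[OF ij(2)] E_closed[OF ij(1)] E_closed[OF ij(2)]
  have adj': "adjacent j i"
    using ij(3) by (simp add: abs_minus_commute)
  have "E i \<otimes> (E j \<otimes> T j) = E j \<otimes> E i \<otimes> T j"
    by (simp add: EE[OF ij(1,2)] flip: m_assoc)
  also have "\<dots> = (E j \<otimes> T j) \<otimes> E i"
    using EET_ETE[OF ij(2,1) adj'] ETE_TEE[OF ij(2,1) adj'] ET_same[OF ij(2)] by simp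
  finally have "E i \<otimes> (E j \<otimes> T j) = (E j \<otimes> T j) \<otimes> E i" .
  from intertwine_mult[OF E_sc[OF ij(1)] this]
  have d: "E i \<otimes> (sc d \<otimes> E j \<otimes> T j) = (sc d \<otimes> E j \<otimes> T j) \<otimes> E i"
    by (simp add: m_assoc)
  have b: "E i \<otimes> (sc b \<otimes> E j) = (sc b \<otimes> E j) \<otimes> E i"
    by (intro intertwine E_sc[OF ij(1)] EE ij; simp)
  show ?thesis
    unfolding T2 by (rule intertwine_add[OF intertwine_add[OF intertwine_one b] d]) simp_all
qed

text \<open>The deformed generator is \<open>F i \<otimes> T i\<close>, where
  \<open>F i = 1 + c E i\<close> commutes with all ties and with \<open>T i\<close>. Far relations
  follow letter by letter; the braid relation also draws on the quadratic relation, through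
  \<open>T_square_comm\<close> and the invertibility of \<open>T j\<close>.\<close>

lemma deformed_tied_braid_ring:
  assumes T2: "\<And>i. i \<in> {1..<n} \<Longrightarrow> T i \<otimes> T i = \<one> \<oplus> sc b \<otimes> E i \<oplus> sc d \<otimes> E i \<otimes> T i"
    and "b \<noteq> - 1"
  shows "tied_braid_ring R n sc (\<lambda>i. T i \<oplus> sc c \<otimes> E i \<otimes> T i) E"
proof -
  let ?V = "\<lambda>i. T i \<oplus> sc c \<otimes> E i \<otimes> T i"
  define F where "F i = \<one> \<oplus> sc c \<otimes> E i" for i
  have F [simp]: "F i \<in> carrier R" if "i \<in> {1..<n}" for i
    using E_closed[OF that] by (simp add: F_def)
  have V: "?V i = F i \<otimes> T i" if "i \<in> {1..<n}" for i
    using E_closed[OF that] T_closed[OF that] by (simp add: F_def l_distr)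
  show ?thesis
  proof unfold_locales
    fix i assume i: "i \<in> {1..<n}"
    note [simp] = T_closed[OF i] E_closed[OF i]
    show "?V i \<in> carrier R" "E i \<in> carrier R"
      by simp_all
    show "E i \<otimes> ?V i = ?V i \<otimes> E i"
      by (intro intertwine E_sc[OF i] ET_same[OF i] refl; simp)
    fix d
    have "sc d \<otimes> ?V i = ?V i \<otimes> sc d"
      by (intro intertwine T_sc[OF i, symmetric] E_sc[OF i, symmetric] sc_comm; simp)
    then show "?V i \<otimes> sc d = sc d \<otimes> ?V i"
      by simp
    show "E i \<otimes> sc d = sc d \<otimes> E i"
      by (rule E_sc[OF i])
  next
    fix i j assume ij: "i \<in> {1..<n}" "j \<in> {1..<n}"
    note [simp] = T_closed[OF ij(1)] T_closed[OF ij(2)] E_closed[OF ij(1)] E_closed[OF ij(2)]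
      F[OF ij(1)] F[OF ij(2)]
    note comm = T_sc[OF ij(1)] T_sc[OF ij(2)] E_sc[OF ij(1)] E_sc[OF ij(2)]
    show "E i \<otimes> E j = E j \<otimes> E i"
      by (rule EE[OF ij])
    {
      assume far: "far i j"
      then have far': "far j i"
        by (simp add: abs_minus_commute)
      show "E i \<otimes> ?V j = ?V j \<otimes> E i"
        by (intro intertwine comm EE[OF ij] ET_far[OF ij far]; simp)
      have "T j \<otimes> ?V i = ?V i \<otimes> T j"
        by (intro intertwine comm TT_far[OF ij(2,1) far'] ET_far[OF ij far, symmetric]; simp)
      moreover have "E j \<otimes> ?V i = ?V i \<otimes> E j"
        by (intro intertwine comm EE[OF ij(2,1)] ET_far[OF ij(2,1) far']; simp)
      moreover have "sc c \<otimes> ?V i = ?V i \<otimes> sc c"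
        by (intro intertwine comm[symmetric] refl; simp)
      ultimately show "?V i \<otimes> ?V j = ?V j \<otimes> ?V i"
        by (intro intertwine) simp_all
    next
      assume adj: "adjacent i j"
      then have adj': "adjacent j i"
        by (simp add: abs_minus_commute)
      have "T i \<otimes> F i = F i \<otimes> T i"
        unfolding F_def by (intro intertwine comm ET_same[OF ij(1), symmetric]; simp)
      note FT = this[symmetric]
      have EF: "E i \<otimes> F j = F j \<otimes> E i" "E j \<otimes> F i = F i \<otimes> E j"
        unfolding F_def by (intro intertwine comm EE ij; simp)+
      \<comment> \<open>In the form \<open>F j T j T i F i\<close> of the deformed product, the
        outer factors commute with ties, so \<open>ETT\<close> is applied to the middle
        \<open>T j T i\<close>.\<close>
      have "T j \<otimes> T i \<otimes> E j = E i \<otimes> (T j \<otimes> T i)"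
        by (simp add: m_assoc flip: ETT[OF ij adj])
      from intertwine_prod[OF this EF(2)[symmetric]]
      have "(T j \<otimes> T i \<otimes> F i) \<otimes> E j = E i \<otimes> (T j \<otimes> T i \<otimes> F i)"
        by simp
      from intertwine_prod[OF EF(1)[symmetric] this]
      have "F j \<otimes> (T j \<otimes> T i \<otimes> F i) \<otimes> E j = E i \<otimes> (F j \<otimes> (T j \<otimes> T i \<otimes> F i))"
        by simp
      then show "E i \<otimes> ?V j \<otimes> ?V i = ?V j \<otimes> ?V i \<otimes> E j"
        unfolding V[OF ij(1)] V[OF ij(2)] FT by (simp add: m_assoc)
      \<comment> \<open>The mixed relations are normalized by \<open>EE\<close> so that the two ties
        occur as \<open>E i \<otimes> E j\<close>, the order \<open>e \<otimes> f\<close> of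
        \<open>deformed_braid_relation\<close>.\<close>
      show "?V i \<otimes> ?V j \<otimes> ?V i = ?V j \<otimes> ?V i \<otimes> ?V j"
        unfolding V[OF ij(1)] V[OF ij(2)] unfolding F_def
        using ETT[OF ij adj] ETT[OF ij(2,1) adj'] EET_ETE[OF ij adj]
          EET_ETE[OF ij(2,1) adj', unfolded EE[OF ij(2,1)]]
          ETE_TEE[OF ij adj] ETE_TEE[OF ij(2,1) adj', folded EE[OF ij]] EE[OF ij]
        by (intro deformed_braid_relation comm EE[OF ij] ET_same ij TTT[OF ij adj]
            T_square_comm[OF ij adj T2[OF ij(2)], symmetric] T_unit_if_quadratic[OF ij(2) T2[OF ij(2)] \<open>b \<noteq> - 1\<close>])
          (simp_all add: m_assoc)
    }
  qed (simp_all add: sc_add sc_mult sc_one)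
qed

lemma deformed_unit:
  assumes "i \<in> {1..<n}" "T i \<in> Units R" "c + d + c * d = 0"
  shows "T i \<oplus> sc c \<otimes> E i \<otimes> T i \<in> Units R"
proof -
  have "T i \<oplus> sc c \<otimes> E i \<otimes> T i = (\<one> \<oplus> sc c \<otimes> E i) \<otimes> T i"
    using T_closed[OF assms(1)] E_closed[OF assms(1)] by (simp add: l_distr)
  then show ?thesis
    using one_plus_tie_unit[OF assms(1,3)] assms(2) by simp
qed

end

section \<open>The bt-algebra\<close>

text \<open>The type of \<open>R\<close> admits polynomials in letters outside \<open>A\<close>;
  \<open>rels_closed\<close> keeps the differences \<open>l - r\<close> in the free algebra on
  \<open>A\<close>, where they generate an ideal.\<close>

locale algebra_presentation =
  fixes A :: "'g set" and R :: "(('g, 'k::field) nc_poly \<times> ('g, 'k) nc_poly) set"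
  assumes rels_closed: "(l, r) \<in> R
    \<Longrightarrow> l \<in> carrier (free_algebra A) \<and> r \<in> carrier (free_algebra A)"
begin

abbreviation F where "F \<equiv> free_algebra A :: ('g, 'k) nc_poly ring"
abbreviation Q where "Q \<equiv> presented_algebra A R"

interpretation F: ring F
  by (rule ring_free_algebra)

lemma free_algebra_ops: "mult F = (*)" "add F = (+)" "one F = 1"
  by (simp_all add: free_algebra_def)

lemma free_algebra_closed:
  "p \<in> carrier F \<Longrightarrow> q \<in> carrier F \<Longrightarrow> p * q \<in> carrier F"
  "p \<in> carrier F \<Longrightarrow> q \<in> carrier F \<Longrightarrow> p + q \<in> carrier F"
  "1 \<in> carrier F"
  by (fact F.m_closed[unfolded free_algebra_ops] F.a_closed[unfolded free_algebra_ops]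
      F.one_closed[unfolded free_algebra_ops])+

lemma uminus_closed: "p \<in> carrier F \<Longrightarrow> - p \<in> carrier F"
  by (simp add: free_algebra_def)

lemma generator_closed: "g \<in> A \<Longrightarrow> nc_gen g \<in> carrier F"
  by (simp add: free_algebra_def nc_gen_def)

lemma const_closed: "nc_const c \<in> carrier F"
  by (simp add: free_algebra_def nc_const_def zero_word_def)

lemma relation_diff_closed: "{l - r | l r. (l, r) \<in> R} \<subseteq> carrier F"
proof clarify
  fix l r assume "(l, r) \<in> R"
  then have "l + - r \<in> carrier F"
    by (intro free_algebra_closed uminus_closed) (simp_all only: rels_closed)
  then show "l - r \<in> carrier F"
    by (simp only: add_uminus_conv_diff)
qed

lemma ideal_relation_ideal: "ideal (relation_ideal A R) F"
  unfolding relation_ideal_def by (rule F.genideal_ideal[OF relation_diff_closed])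

lemma ring_presented_algebra: "ring Q"
  unfolding presented_algebra_def by (rule ideal.quotient_is_ring[OF ideal_relation_ideal])

lemma alg_class_hom: "alg_class A R \<in> ring_hom F Q"
  using ideal.rcos_ring_hom[OF ideal_relation_ideal]
  by (simp only: alg_class_def[abs_def] presented_algebra_def)

lemma alg_class_closed: "p \<in> carrier F \<Longrightarrow> alg_class A R p \<in> carrier Q"
  by (rule ring_hom_closed[OF alg_class_hom])

lemma alg_class_mult:
  "p \<in> carrier F \<Longrightarrow> q \<in> carrier F
    \<Longrightarrow> alg_class A R (p * q) = alg_class A R p \<otimes>\<^bsub>Q\<^esub> alg_class A R q"
  using ring_hom_mult[OF alg_class_hom, of p q] by (simp only: free_algebra_ops)

lemma alg_class_add:
  "p \<in> carrier F \<Longrightarrow> q \<in> carrier F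
    \<Longrightarrow> alg_class A R (p + q) = alg_class A R p \<oplus>\<^bsub>Q\<^esub> alg_class A R q"
  using ring_hom_add[OF alg_class_hom, of p q] by (simp only: free_algebra_ops)

lemma alg_class_one: "alg_class A R 1 = \<one>\<^bsub>Q\<^esub>"
  using ring_hom_one[OF alg_class_hom] by (simp only: free_algebra_ops)

lemmas alg_class_simps = alg_class_mult alg_class_add alg_class_one
  free_algebra_closed generator_closed const_closed

lemma alg_class_eq:
  assumes "(l, r) \<in> R"
  shows "alg_class A R l = alg_class A R r"
proof -
  interpret Q: ring Q by (rule ring_presented_algebra)
  have closed: "r \<in> carrier F"
    using assms rels_closed by blast
  have "l - r \<in> relation_ideal A R"
    unfolding relation_ideal_def using assms F.genideal_self[OF relation_diff_closed] by blast
  then have zero: "alg_class A R (l - r) = \<zero>\<^bsub>Q\<^esub>"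
    using F.a_rcos_zero[OF ideal_relation_ideal]
    by (simp only: alg_class_def presented_algebra_def FactRing_def ring.simps)
  have "l - r \<in> carrier F"
    using relation_diff_closed assms by blast
  \<comment> \<open>Additivity is applied to \<open>l = (l - r) + r\<close>, whose first summand has
    class zero.\<close>
  from alg_class_add[OF this closed] show ?thesis
    using alg_class_closed[OF closed] by (simp add: zero)
qed

end

section \<open>The two presentations as tied-braid rings\<close>

text \<open>Constants are supported on the empty word, the unit of the free monoid, which is why
  they commute with generators.\<close>

lemma nc_const_simps:
  "nc_const (c + d) = nc_const c + nc_const d"
  "nc_const (c * d) = nc_const c * nc_const d"
  "nc_const 1 = 1"
  "nc_gen g * nc_const c = nc_const c * nc_gen g"
  by (simp_all add: nc_const_def nc_gen_def single_add mult_single)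

text \<open>Stated for any \<open>R\<close> containing the common relations, to serve both
  presentations. Each axiom is rewritten as an equality of classes of two polynomials, which either
  are equal in the free algebra or form a pair in \<open>R\<close>.\<close>

lemma bt_ring_presented_algebra:
  assumes "algebra_presentation (bt_gens n) R" and common: "bt_common_rels n \<subseteq> R"
  defines "cl \<equiv> alg_class (bt_gens n) R"
  shows "bt_ring (presented_algebra (bt_gens n) R) n
    (\<lambda>c. cl (nc_const c)) (\<lambda>i. cl (tT i)) (\<lambda>i. cl (tE i))"
proof -
  interpret algebra_presentation "bt_gens n" R by fact
  interpret Q: ring Q by (rule ring_presented_algebra)
  have gens: "Braid_gen i \<in> bt_gens n" "Tie_gen i \<in> bt_gens n" if "i \<in> {1..<n}" for i
    using that by (auto simp: bt_gens_def)
  note closed = free_algebra_closed generator_closed const_closed gens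
  have cl_ops: "cl p \<otimes>\<^bsub>Q\<^esub> cl q = cl (p * q)" "cl p \<oplus>\<^bsub>Q\<^esub> cl q = cl (p + q)"
    if "p \<in> carrier F" "q \<in> carrier F" for p q
    by (simp_all only: cl_def alg_class_mult[OF that] alg_class_add[OF that])
  have cl_closed: "cl p \<in> carrier Q" if "p \<in> carrier F" for p
    unfolding cl_def using that by (rule alg_class_closed)
  have cl_one: "\<one>\<^bsub>Q\<^esub> = cl 1"
    by (simp only: cl_def alg_class_one)
  note rel = bt_common_rels.intros[THEN common[THEN subsetD], THEN alg_class_eq, folded cl_def,
      unfolded power2_eq_square]
  show ?thesis
    by unfold_locales
      (simp_all only: cl_ops cl_one closed nc_const_simps cl_closed, (rule rel; assumption)+)
qed

lemma bt_common_rels_closed: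
  assumes "(l, r) \<in> bt_common_rels n"
  shows "l \<in> carrier (free_algebra (bt_gens n)) \<and> r \<in> carrier (free_algebra (bt_gens n))"
proof -
  \<comment> \<open>The empty presentation supplies the closure facts of the free algebra.\<close>
  interpret algebra_presentation "bt_gens n" "{}"
    by unfold_locales simp
  have gens: "Braid_gen i \<in> bt_gens n" "Tie_gen i \<in> bt_gens n" if "i \<in> {1..<n}" for i
    using that by (auto simp: bt_gens_def)
  show ?thesis
    using assms
    by cases (simp_all add: free_algebra_closed generator_closed gens power2_eq_square
        del: atLeastLessThan_iff One_nat_def)
qed

lemma bt_presentations:
  "algebra_presentation (bt_gens n) (bt_rels n u)"
  "algebra_presentation (bt_gens n) (btV_rels n v)"
proof -
  interpret F: algebra_presentation "bt_gens n" "{}"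
    by unfold_locales simp
  have gens: "Braid_gen i \<in> bt_gens n" "Tie_gen i \<in> bt_gens n" if "i \<in> {1..<n}" for i
    using that by (auto simp: bt_gens_def)
  note closed = F.free_algebra_closed F.generator_closed F.const_closed gens power2_eq_square
  show "algebra_presentation (bt_gens n) (bt_rels n u)"
    unfolding algebra_presentation_def bt_rels_def using bt_common_rels_closed
    by (auto simp only: closed Un_iff mem_Collect_eq prod.inject)
  show "algebra_presentation (bt_gens n) (btV_rels n v)"
    unfolding algebra_presentation_def btV_rels_def using bt_common_rels_closed
    by (auto simp only: closed Un_iff mem_Collect_eq prod.inject)
qed

lemma bt_ring_bt_algebra:
  "bt_ring (bt_algebra n u) n (bt_scalar n u) (bt_T n u) (bt_E n u)"
  using bt_ring_presented_algebra[OF bt_presentations(1), of n u]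
  by (simp add: bt_algebra_def bt_scalar_def[abs_def] bt_T_def[abs_def] bt_E_def[abs_def] bt_rels_def)

lemma bt_ring_btV_algebra:
  "bt_ring (btV_algebra n v) n (btV_scalar n v) (btV_V n v) (btV_E n v)"
  using bt_ring_presented_algebra[OF bt_presentations(2), of n v]
  by (simp add: btV_algebra_def btV_scalar_def[abs_def] btV_V_def[abs_def] btV_E_def[abs_def] btV_rels_def)

section \<open>Quadratic relations and invertible generators\<close>

lemma bt_T_square:
  fixes u :: "'k::field"
  assumes "i \<in> {1..<n}"
  defines "A \<equiv> bt_algebra n u"
  shows "bt_T n u i \<otimes>\<^bsub>A\<^esub> bt_T n u i = \<one>\<^bsub>A\<^esub> \<oplus>\<^bsub>A\<^esub> bt_scalar n u (u - 1) \<otimes>\<^bsub>A\<^esub> bt_E n u i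
    \<oplus>\<^bsub>A\<^esub> bt_scalar n u (u - 1) \<otimes>\<^bsub>A\<^esub> bt_E n u i \<otimes>\<^bsub>A\<^esub> bt_T n u i"
proof -
  interpret algebra_presentation "bt_gens n" "bt_rels n u"
    by (rule bt_presentations)
  have gens: "Braid_gen i \<in> bt_gens n" "Tie_gen i \<in> bt_gens n"
    using assms by (auto simp: bt_gens_def)
  have "(tT i ^ 2, 1 + nc_const (u - 1) * tE i + nc_const (u - 1) * tE i * tT i) \<in> bt_rels n u"
    using assms by (auto simp: bt_rels_def)
  from alg_class_eq[OF this] show ?thesis
    by (simp add: A_def bt_algebra_def bt_T_def bt_E_def bt_scalar_def alg_class_simps gens
        power2_eq_square)
qed

lemma btV_V_square:
  fixes v :: "'k::field"
  assumes "i \<in> {1..<n}"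
  defines "A \<equiv> btV_algebra n v"
  shows "btV_V n v i \<otimes>\<^bsub>A\<^esub> btV_V n v i
    = \<one>\<^bsub>A\<^esub> \<oplus>\<^bsub>A\<^esub> btV_scalar n v (v - inverse v) \<otimes>\<^bsub>A\<^esub> btV_E n v i \<otimes>\<^bsub>A\<^esub> btV_V n v i"
proof -
  interpret algebra_presentation "bt_gens n" "btV_rels n v"
    by (rule bt_presentations)
  have gens: "Braid_gen i \<in> bt_gens n" "Tie_gen i \<in> bt_gens n"
    using assms by (auto simp: bt_gens_def)
  have "(tT i ^ 2, 1 + nc_const (v - inverse v) * tE i * tT i) \<in> btV_rels n v"
    using assms by (auto simp: btV_rels_def)
  from alg_class_eq[OF this] show ?thesis
    by (simp add: A_def btV_algebra_def btV_V_def btV_E_def btV_scalar_def alg_class_simps gens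
        power2_eq_square)
qed

text \<open>Here \<open>b = u - 1\<close>, so the condition \<open>b \<noteq> - 1\<close> becomes
  \<open>u \<noteq> 0\<close>.\<close>

lemma bt_T_unit:
  assumes "u \<noteq> 0" "i \<in> {1..<n}"
  shows "bt_T n u i \<in> Units (bt_algebra n u)"
  by (rule bt_ring.T_unit_if_quadratic[OF bt_ring_bt_algebra assms(2) bt_T_square[OF assms(2)]])
    (use assms(1) in simp)

text \<open>Here \<open>b = 0\<close>, which differs from \<open>- 1\<close> in every field.\<close>

lemma btV_V_unit:
  assumes "i \<in> {1..<n}"
  shows "btV_V n v i \<in> Units (btV_algebra n v)"
proof -
  interpret bt_ring "btV_algebra n v" n "btV_scalar n v" "btV_V n v" "btV_E n v"
    by (rule bt_ring_btV_algebra)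
  show ?thesis
    using T_unit_if_quadratic[OF assms, of 0 "v - inverse v"] btV_V_square[OF assms, of v]
      E_closed[OF assms] by (simp add: sc_zero)
qed

lemma bt_V_eq:
  "bt_V n v = (\<lambda>i. let A = bt_algebra n (v ^ 2) in bt_T n (v ^ 2) i \<oplus>\<^bsub>A\<^esub>
    bt_scalar n (v ^ 2) (inverse v - 1) \<otimes>\<^bsub>A\<^esub> bt_E n (v ^ 2) i \<otimes>\<^bsub>A\<^esub> bt_T n (v ^ 2) i)"
  by (simp add: bt_V_def fun_eq_iff)

text \<open>The deformation has \<open>c = inverse v - 1\<close>, and \<open>b = v ^ 2 - 1\<close>
  differs from \<open>- 1\<close> because \<open>v \<noteq> 0\<close>.\<close>

lemma tied_braid_ring_bt_V:
  assumes "v \<noteq> 0"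
  shows "tied_braid_ring (bt_algebra n (v ^ 2)) n (bt_scalar n (v ^ 2)) (bt_V n v) (bt_E n (v ^ 2))"
proof -
  interpret bt_ring "bt_algebra n (v ^ 2)" n "bt_scalar n (v ^ 2)" "bt_T n (v ^ 2)" "bt_E n (v ^ 2)"
    by (rule bt_ring_bt_algebra)
  show ?thesis
    unfolding bt_V_eq Let_def
    by (rule deformed_tied_braid_ring[OF bt_T_square]) (use assms in auto)
qed

lemma bt_V_unit:
  assumes "v \<noteq> 0" "i \<in> {1..<n}"
  shows "bt_V n v i \<in> Units (bt_algebra n (v ^ 2))"
proof -
  interpret bt_ring "bt_algebra n (v ^ 2)" n "bt_scalar n (v ^ 2)" "bt_T n (v ^ 2)" "bt_E n (v ^ 2)"
    by (rule bt_ring_bt_algebra)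
  \<comment> \<open>With \<open>1 + c = inverse v\<close>, the inverse scalar \<open>1 + d\<close>
    is \<open>v\<close>, so \<open>d = v - 1\<close>.\<close>
  have "inverse v - 1 + (v - 1) + (inverse v - 1) * (v - 1) = 0"
    using assms(1) by (simp add: field_simps)
  from deformed_unit[OF assms(2) bt_T_unit[OF _ assms(2)] this] show ?thesis
    using assms(1) by (simp add: bt_V_def Let_def)
qed

section \<open>Nonvanishing of the indeterminates\<close>

lemma rf_const_eq_0_iff: "rf_const c = 0 \<longleftrightarrow> c = 0"
  by (simp add: rf_const_def Zero_fract_def eq_fract)

lemma rf_var_nonzero: "rf_var \<noteq> 0"
  by (simp add: rf_var_def Zero_fract_def eq_fract)

lemma ext_const_eq_0_iff: "ext_const c = 0 \<longleftrightarrow> c = 0"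
  by (simp add: ext_const_def rf_const_eq_0_iff)


theorem proposition6:
  fixes n :: nat
  assumes "n \<ge> 1"
  shows
    "(let u = ext_const (rf_var :: complex ratfun);
          x = ext_x; y = ext_y; w = ext_w;
          A = bt_algebra n u; c = bt_scalar n u; T = bt_T n u; E = bt_E n u
      in
        defines_SB_hom n A
          (\<lambda>i. c w \<otimes>\<^bsub>A\<^esub> T i)
          (\<lambda>i. c x \<oplus>\<^bsub>A\<^esub> c (y * w) \<otimes>\<^bsub>A\<^esub> T i) \<and>
        defines_SB_hom n A
          (\<lambda>i. c w \<otimes>\<^bsub>A\<^esub> T i)
          (\<lambda>i. c x \<otimes>\<^bsub>A\<^esub> E i \<oplus>\<^bsub>A\<^esub> c (y * w) \<otimes>\<^bsub>A\<^esub> E i \<otimes>\<^bsub>A\<^esub> T i)) \<and>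
     (let v = ext_const (rf_var :: complex ratfun);
          x = ext_x; y = ext_y; w = ext_w;
          A = btV_algebra n v; c = btV_scalar n v; V = btV_V n v; E = btV_E n v
      in
        defines_SB_hom n A
          (\<lambda>i. c w \<otimes>\<^bsub>A\<^esub> V i)
          (\<lambda>i. c x \<oplus>\<^bsub>A\<^esub> c (y * w) \<otimes>\<^bsub>A\<^esub> V i) \<and>
        defines_SB_hom n A
          (\<lambda>i. c w \<otimes>\<^bsub>A\<^esub> V i)
          (\<lambda>i. c x \<otimes>\<^bsub>A\<^esub> E i \<oplus>\<^bsub>A\<^esub> c (y * w) \<otimes>\<^bsub>A\<^esub> E i \<otimes>\<^bsub>A\<^esub> V i)) \<and>
     (let v = ext_const (rf_var :: complex ratfun); u = v ^ 2;
          x = ext_x; y = ext_y; w = ext_w;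
          A = bt_algebra n u; c = bt_scalar n u; V = bt_V n v; E = bt_E n u
      in
        defines_SB_hom n A
          (\<lambda>i. c w \<otimes>\<^bsub>A\<^esub> V i)
          (\<lambda>i. c x \<oplus>\<^bsub>A\<^esub> c (y * w) \<otimes>\<^bsub>A\<^esub> V i) \<and>
        defines_SB_hom n A
          (\<lambda>i. c w \<otimes>\<^bsub>A\<^esub> V i)
          (\<lambda>i. c x \<otimes>\<^bsub>A\<^esub> E i \<oplus>\<^bsub>A\<^esub> c (y * w) \<otimes>\<^bsub>A\<^esub> E i \<otimes>\<^bsub>A\<^esub> V i))"
proof -
  \<comment> \<open>One indeterminate plays \<open>u\<close> in the first pair of claims and
    \<open>v\<close> in the other two pairs; in the last pair \<open>u\<close> is its
    square.\<close>
  let ?t = "ext_const (rf_var :: complex ratfun)"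
  have t: "?t \<noteq> 0" and w: "ext_w \<noteq> 0"
    by (simp_all add: ext_const_eq_0_iff rf_var_nonzero ext_w_def)
  interpret T: bt_ring "bt_algebra n ?t" n "bt_scalar n ?t" "bt_T n ?t" "bt_E n ?t"
    by (rule bt_ring_bt_algebra)
  interpret V: bt_ring "btV_algebra n ?t" n "btV_scalar n ?t" "btV_V n ?t" "btV_E n ?t"
    by (rule bt_ring_btV_algebra)
  interpret V': tied_braid_ring "bt_algebra n (?t ^ 2)" n "bt_scalar n (?t ^ 2)"
      "bt_V n ?t" "bt_E n (?t ^ 2)"
    by (rule tied_braid_ring_bt_V[OF t])
  show ?thesis
    \<comment> \<open>The general coefficient \<open>z\<close> is instantiated to
      \<open>y * w\<close> by unification.\<close>
    unfolding Let_def
    by (intro conjI T.defines_SB_hom T.defines_SB_hom_one V.defines_SB_hom V.defines_SB_hom_one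
        V'.defines_SB_hom V'.defines_SB_hom_one bt_T_unit[OF t] btV_V_unit bt_V_unit[OF t] w)
qed

end
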